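(* Let $f:\mathbb{R}^n\to\mathbb{R}$ be $\alpha$-strongly convex and $\beta$-smooth, with $\alpha,\beta>0$, $\kappa=\beta/\alpha$ and minimizer $x^*$. Let Nesterov's accelerated gradient descent be defined by an arbitrary $x_1=y_1\in\mathbb{R}^n$ and, for $t\ge 1$, $$y_{t+1}=x_t-\frac1\beta\nabla f(x_t),\qquad x_{t+1}=\left(1+\frac{\sqrt\kappa-1}{\sqrt\kappa+1}\right)y_{t+1}-\frac{\sqrt\kappa-1}{\sqrt\kappa+1}y_t.$$ Then for every $t\ge 1$, $$f(y_t)-f(x^* )\le\frac{\alpha+\beta}{2}\|x_1-x^*\|^2\exp\left(-\frac{t-1}{\sqrt\kappa}\right).$$
   Context: $\|\cdot\|$ is the Euclidean norm. A continuously differentiable $f$ is $\beta$-smooth if $\|\nabla f(x)-\nabla f(y)\|\le\beta\|x-y\|$ for all $x,y$, and $\alpha$-strongly convex if $f(x)-f(y)\le\nabla f(x)^\top(x-y)-\frac\alpha2\|x-y\|^2$ for all $x,y$. *)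

theory Defs
  imports "HOL-Analysis.Analysis"
begin

definition grad :: "('a::euclidean_space \<Rightarrow> real) \<Rightarrow> 'a \<Rightarrow> 'a" where
  "grad f x = (THE D. GDERIV f x :> D)"

lemma grad_eqI:
  assumes "GDERIV f x :> D"
  shows "grad f x = D"
  unfolding grad_def
proof (rule the_equality)
  show "GDERIV f x :> D" by (rule assms)
next
  fix E assume "GDERIV f x :> E"
  then have "(\<lambda>h. h \<bullet> E) = (\<lambda>h. h \<bullet> D)"
    using assms unfolding gderiv_def by (rule has_derivative_unique)
  then show "E = D"
    by (auto simp: fun_eq_iff intro: vector_eq_ldot[THEN iffD1])
qed

lemma GDERIV_grad:
  fixes f :: "'a::euclidean_space \<Rightarrow> real"
  assumes "f differentiable (at x)"
  shows "GDERIV f x :> grad f x"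
proof -
  from assms obtain L where L: "(f has_derivative L) (at x)"
    by (auto simp: differentiable_def)
  have lin: "linear L"
    using L by (rule has_derivative_linear)
  have "h \<bullet> adjoint L 1 = L h" for h
    using adjoint_works[OF lin, of h 1] by simp
  then have "GDERIV f x :> adjoint L 1"
    using L by (simp add: gderiv_def)
  then show ?thesis
    by (simp add: grad_eqI)
qed

definition continuously_differentiable :: "('a::euclidean_space \<Rightarrow> real) \<Rightarrow> bool" where
  "continuously_differentiable f \<longleftrightarrow>
     (\<forall>x. f differentiable (at x)) \<and> continuous_on UNIV (grad f)"

definition smooth :: "real \<Rightarrow> ('a::euclidean_space \<Rightarrow> real) \<Rightarrow> bool" where
  "smooth \<beta> f \<longleftrightarrow> continuously_differentiable f \<and>
     (\<forall>x y. norm (grad f x - grad f y) \<le> \<beta> * norm (x - y))"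

definition strongly_convex :: "real \<Rightarrow> ('a::euclidean_space \<Rightarrow> real) \<Rightarrow> bool" where
  "strongly_convex \<alpha> f \<longleftrightarrow> continuously_differentiable f \<and>
     (\<forall>x y. f x - f y \<le> grad f x \<bullet> (x - y) - \<alpha> / 2 * (norm (x - y))\<^sup>2)"

end

theory Submission
  imports Defs
begin

text \<open>
  Write \<open>s = sqrt \<kappa>\<close> and \<open>q = 1 / s\<close>, so that \<open>\<beta> = \<alpha> s\<^sup>2\<close>. The proof attaches to the two sequences of the
  method the third one \<open>z\<^sub>t = (1 + s) x\<^sub>t - s y\<^sub>t\<close>, which starts at \<open>z\<^sub>1 = x\<^sub>1\<close>, and shows that the potential
  \<open>V\<^sub>t = f y\<^sub>t - f x\<^sup>* + \<alpha>/2 |z\<^sub>t - x\<^sup>*|\<^sup>2\<close> shrinks by the factor \<open>1 - q\<close> in every step.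

  In terms of \<open>z\<close> the momentum update is a gradient step of size \<open>q / \<alpha>\<close> from an average,
  \<open>z\<^sub>t\<^sub>+\<^sub>1 = (1 - q) z\<^sub>t + q x\<^sub>t - (q / \<alpha>) g\<close> with \<open>g = \<nabla>f x\<^sub>t\<close>. Expanding \<open>|z\<^sub>t\<^sub>+\<^sub>1 - x\<^sup>*|\<^sup>2\<close> produces the term
  \<open>q\<^sup>2 / (2 \<alpha>) |g|\<^sup>2 = |g|\<^sup>2 / (2 \<beta>)\<close>, which is exactly the decrease of \<open>f\<close> that smoothness guarantees from
  \<open>x\<^sub>t\<close> to \<open>y\<^sub>t\<^sub>+\<^sub>1\<close>. The remaining inner product with \<open>g\<close> is \<open>(1 - q) (x\<^sub>t - y\<^sub>t) + q (x\<^sub>t - x\<^sup>*)\<close>, and strong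
  convexity at \<open>x\<^sub>t\<close>, used against \<open>y\<^sub>t\<close> and against \<open>x\<^sup>*\<close> with these two weights, bounds what is left by
  \<open>(1 - q) V\<^sub>t\<close>. This is \<open>nesterov_potential_step\<close>.

  Iterating gives \<open>V\<^sub>t \<le> (1 - q)\<^sup>t\<^sup>-\<^sup>1 V\<^sub>1\<close>. Here \<open>1 - q \<le> exp (- q)\<close>, and \<open>V\<^sub>1 \<le> (\<alpha> + \<beta>)/2 |x\<^sub>1 - x\<^sup>*|\<^sup>2\<close> because
  a \<open>\<beta>\<close>-smooth function grows at most quadratically around its minimizer
  (\<open>smooth_growth_from_minimizer\<close>).
\<close>

section \<open>Quadratic bounds for smooth and strongly convex functions\<close>

text \<open>
  The derivative of \<open>f (x + t (y - x))\<close> in \<open>t\<close> exceeds its value at \<open>t = 0\<close> by at most \<open>t \<beta> |y - x|\<^sup>2\<close>, by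
  Cauchy-Schwarz and the Lipschitz bound on the gradient. So \<open>\<phi>\<close>, which is \<open>f\<close> minus the
  quadratic bound up to the constant \<open>f x\<close>, is nonincreasing in \<open>t\<close>.
\<close>

lemma smooth_upper_quadratic:
  assumes "smooth \<beta> f"
  shows "f y \<le> f x + grad f x \<bullet> (y - x) + \<beta> / 2 * (norm (y - x))\<^sup>2"
proof -
  define d where "d = y - x"
  define \<phi> where "\<phi> t = f (x + t *\<^sub>R d) - t * (grad f x \<bullet> d) - \<beta> / 2 * t\<^sup>2 * (norm d)\<^sup>2" for t :: real
  have "\<phi> 1 \<le> \<phi> 0"
  proof (rule DERIV_nonpos_imp_nonincreasing[where f = \<phi>])
    fix t :: real
    assume t: "0 \<le> t" "t \<le> 1"
    define G where "G = grad f (x + t *\<^sub>R d)"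
    have "GDERIV f (x + t *\<^sub>R d) :> G"
      using assms by (auto simp: G_def smooth_def continuously_differentiable_def intro: GDERIV_grad)
    then have "(f has_derivative (\<lambda>h. h \<bullet> G)) (at (x + t *\<^sub>R d))"
      by (simp add: gderiv_def)
    moreover have "((\<lambda>t. x + t *\<^sub>R d) has_derivative (\<lambda>h. h *\<^sub>R d)) (at t)"
      by (auto intro!: derivative_eq_intros)
    ultimately have "((\<lambda>t. f (x + t *\<^sub>R d)) has_derivative (\<lambda>h. (h *\<^sub>R d) \<bullet> G)) (at t)"
      using has_derivative_compose by blast
    then have f': "((\<lambda>t. f (x + t *\<^sub>R d)) has_real_derivative G \<bullet> d) (at t)"
      by (rule has_derivative_imp_has_field_derivative) (simp add: inner_commute)
    have "(\<phi> has_real_derivative G \<bullet> d - grad f x \<bullet> d - \<beta> * t * (norm d)\<^sup>2) (at t)"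
      unfolding \<phi>_def by (rule derivative_eq_intros f' refl | simp)+
    moreover have "G \<bullet> d - grad f x \<bullet> d \<le> \<beta> * t * (norm d)\<^sup>2"
    proof -
      have "norm (G - grad f x) \<le> \<beta> * norm ((x + t *\<^sub>R d) - x)"
        using assms unfolding smooth_def G_def by blast
      then have "norm (G - grad f x) \<le> \<beta> * t * norm d"
        using t by simp
      then have "norm (G - grad f x) * norm d \<le> \<beta> * t * norm d * norm d"
        by (rule mult_right_mono) simp
      moreover have "(G - grad f x) \<bullet> d \<le> norm (G - grad f x) * norm d"
        by (rule norm_cauchy_schwarz)
      ultimately show ?thesis
        by (simp add: inner_diff_left power2_eq_square mult.assoc)
    qed
    ultimately show "\<exists>l. (\<phi> has_real_derivative l) (at t) \<and> l \<le> 0"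
      by (metis diff_le_0_iff_le)
  qed simp
  then show ?thesis
    by (simp add: \<phi>_def d_def)
qed

text \<open>
  The step size \<open>1 / \<beta>\<close> minimizes the quadratic upper bound along the negative gradient.
\<close>

lemma smooth_gradient_step_decrease:
  assumes "smooth \<beta> f" and "\<beta> > 0"
  shows "f (x - (1 / \<beta>) *\<^sub>R grad f x) \<le> f x - (norm (grad f x))\<^sup>2 / (2 * \<beta>)"
proof -
  define h where "h = - ((1 / \<beta>) *\<^sub>R grad f x)"
  have "f (x + h) \<le> f x + grad f x \<bullet> h + \<beta> / 2 * (norm h)\<^sup>2"
    using smooth_upper_quadratic[OF assms(1), of "x + h" x] by simp
  moreover have "grad f x \<bullet> h = - ((norm (grad f x))\<^sup>2 / \<beta>)"
    by (simp add: h_def power2_norm_eq_inner)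
  moreover have "\<beta> / 2 * (norm h)\<^sup>2 = (norm (grad f x))\<^sup>2 / \<beta> / 2"
    using assms(2) by (simp add: h_def power2_eq_square)
  ultimately have "f (x + h) \<le> f x - (norm (grad f x))\<^sup>2 / \<beta> / 2"
    by linarith
  then show ?thesis
    by (simp add: h_def mult.commute)
qed

text \<open>
  A nonzero gradient at a minimizer would let a gradient step go below the minimum, so the linear
  term of the quadratic upper bound vanishes there.
\<close>

lemma smooth_growth_from_minimizer:
  assumes "smooth \<beta> f" and "\<beta> > 0" and "\<And>z. f m \<le> f z"
  shows "f x - f m \<le> \<beta> / 2 * (norm (x - m))\<^sup>2"
proof -
  have "(norm (grad f m))\<^sup>2 / (2 * \<beta>) \<le> 0"
    using smooth_gradient_step_decrease[OF assms(1,2), of m] assms(3)[of "m - (1 / \<beta>) *\<^sub>R grad f m"]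
    by linarith
  then have "grad f m = 0"
    using assms(2) by (simp add: divide_le_0_iff)
  then show ?thesis
    using smooth_upper_quadratic[OF assms(1), of x m] by simp
qed

text \<open>
  Any two distinct points witness this, since \<open>f\<close> lies between the two quadratic bounds there; a
  point of the basis and the origin will do. The inequality makes \<open>\<kappa> \<ge> 1\<close>, so that the contraction factor \<open>1 - 1 / sqrt \<kappa>\<close> is nonnegative.
\<close>

lemma strongly_convex_smooth_le:
  fixes f :: "'a::euclidean_space \<Rightarrow> real"
  assumes "strongly_convex \<alpha> f" and "smooth \<beta> f"
  shows "\<alpha> \<le> \<beta>"
proof -
  obtain b :: 'a where b: "b \<in> Basis"
    using nonempty_Basis by blast
  have "f 0 - f b \<le> grad f 0 \<bullet> (0 - b) - \<alpha> / 2 * (norm (0 - b))\<^sup>2"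
    using assms(1) unfolding strongly_convex_def by blast
  moreover have "f b \<le> f 0 + grad f 0 \<bullet> (b - 0) + \<beta> / 2 * (norm (b - 0))\<^sup>2"
    by (rule smooth_upper_quadratic[OF assms(2)])
  ultimately show ?thesis
    using b by simp
qed

section \<open>The potential of the accelerated method\<close>

lemma norm_convex_comb_sq_le:
  fixes u v :: "'a::real_inner"
  assumes "0 \<le> q" and "q \<le> 1"
  shows "(norm ((1 - q) *\<^sub>R u + q *\<^sub>R v))\<^sup>2 \<le> (1 - q) * (norm u)\<^sup>2 + q * (norm v)\<^sup>2"
proof -
  have "(1 - q) * (norm u)\<^sup>2 + q * (norm v)\<^sup>2 - (norm ((1 - q) *\<^sub>R u + q *\<^sub>R v))\<^sup>2
      = q * (1 - q) * (norm (u - v))\<^sup>2"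
    unfolding power2_norm_eq_inner by (simp add: inner_simps inner_commute algebra_simps)
  moreover have "\<dots> \<ge> 0"
    using assms by simp
  ultimately show ?thesis
    by linarith
qed

text \<open>
  The point \<open>z'\<close> is what \<open>(1 + s) x' - s y'\<close> becomes when \<open>x'\<close> is the momentum update of \<open>y'\<close> and \<open>y\<close>, whose
  weight \<open>(s - 1) / (s + 1)\<close> cancels against the factor \<open>1 + s\<close>. The squared gradient that arises in
  \<open>|z' - m|\<^sup>2\<close> is paid for by the decrease of \<open>f\<close> in the gradient step, because \<open>\<beta> = \<alpha> s\<^sup>2\<close>. Strong
  convexity pays for the rest: its quadratic term against \<open>m\<close> cancels the share of \<open>|x - m|\<^sup>2\<close> in the
  convex combination \<open>w\<close>.
\<close>

lemma nesterov_potential_step: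
  fixes f :: "'a::euclidean_space \<Rightarrow> real"
  assumes "\<alpha> > 0" and "s \<ge> 1" and \<beta>: "\<beta> = \<alpha> * s\<^sup>2"
    and sc: "strongly_convex \<alpha> f" and sm: "smooth \<beta> f"
    and y': "y' = x - (1 / \<beta>) *\<^sub>R grad f x"
    and z: "z = (1 + s) *\<^sub>R x - s *\<^sub>R y"
    and z': "z' = s *\<^sub>R y' - (s - 1) *\<^sub>R y"
  shows "f y' - f m + \<alpha> / 2 * (norm (z' - m))\<^sup>2
    \<le> (1 - 1 / s) * (f y - f m + \<alpha> / 2 * (norm (z - m))\<^sup>2)"
proof -
  define q where "q = 1 / s"
  define g where "g = grad f x"
  define w where "w = (1 - q) *\<^sub>R (z - m) + q *\<^sub>R (x - m)"
  have q: "0 < q" "q \<le> 1" and s0: "s > 0"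
    using \<open>s \<ge> 1\<close> by (auto simp: q_def)
  have qs: "q * s = 1"
    using s0 by (simp add: q_def)
  have \<beta>0: "\<beta> > 0"
    using \<open>\<alpha> > 0\<close> s0 by (simp add: \<beta>)
  have size: "s / \<beta> = q / \<alpha>"
    using \<open>\<alpha> > 0\<close> s0 by (simp add: \<beta> q_def field_simps power2_eq_square)
  \<comment> \<open>Eliminating \<open>z\<close> shows that \<open>z'\<close> is a gradient step from \<open>w + m\<close>.\<close>
  have w_eq: "w = s *\<^sub>R x - (s - 1) *\<^sub>R y - m"
  proof -
    have "w = ((1 - q) * (1 + s) + q) *\<^sub>R x - ((1 - q) * s) *\<^sub>R y - m"
      by (simp add: w_def z algebra_simps)
    moreover have "(1 - q) * (1 + s) + q = s" and "(1 - q) * s = s - 1"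
      using qs by (simp_all add: algebra_simps)
    ultimately show ?thesis
      by simp
  qed
  have z'_eq: "z' - m = w - (q / \<alpha>) *\<^sub>R g"
    by (simp add: z' y' w_eq g_def size[symmetric] algebra_simps)
  have qw: "q *\<^sub>R w = (1 - q) *\<^sub>R (x - y) + q *\<^sub>R (x - m)"
  proof -
    have "q *\<^sub>R w = (q * s) *\<^sub>R x - (q * s - q) *\<^sub>R y - q *\<^sub>R m"
      by (simp add: w_eq algebra_simps)
    then show ?thesis
      by (simp add: qs algebra_simps)
  qed
  have "\<alpha> / 2 * (norm (z' - m))\<^sup>2
      = \<alpha> / 2 * (norm w)\<^sup>2 - q * (g \<bullet> w) + q\<^sup>2 / (2 * \<alpha>) * (norm g)\<^sup>2"
    unfolding z'_eq power2_norm_eq_inner using \<open>\<alpha> > 0\<close>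
    by (simp add: inner_simps inner_commute field_simps power2_eq_square)
  also have "q\<^sup>2 / (2 * \<alpha>) = 1 / (2 * \<beta>)"
    by (simp add: \<beta> q_def power_divide)
  also have "q * (g \<bullet> w) = (1 - q) * (g \<bullet> (x - y)) + q * (g \<bullet> (x - m))"
    using arg_cong[OF qw, of "\<lambda>v. g \<bullet> v"] by (simp add: inner_add_right)
  finally have dist: "\<alpha> / 2 * (norm (z' - m))\<^sup>2 = \<alpha> / 2 * (norm w)\<^sup>2
      - ((1 - q) * (g \<bullet> (x - y)) + q * (g \<bullet> (x - m))) + (norm g)\<^sup>2 / (2 * \<beta>)"
    by simp
  have "(norm w)\<^sup>2 \<le> (1 - q) * (norm (z - m))\<^sup>2 + q * (norm (x - m))\<^sup>2"
    unfolding w_def using q by (intro norm_convex_comb_sq_le) auto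
  then have "\<alpha> / 2 * (norm w)\<^sup>2
      \<le> \<alpha> / 2 * ((1 - q) * (norm (z - m))\<^sup>2 + q * (norm (x - m))\<^sup>2)"
    using \<open>\<alpha> > 0\<close> by (intro mult_left_mono) auto
  moreover have "f y' \<le> f x - (norm g)\<^sup>2 / (2 * \<beta>)"
    unfolding y' g_def by (rule smooth_gradient_step_decrease[OF sm \<beta>0])
  moreover have "(1 - q) * (f x - f y) \<le> (1 - q) * (g \<bullet> (x - y))"
  proof (rule mult_left_mono)
    have "f x - f y \<le> g \<bullet> (x - y) - \<alpha> / 2 * (norm (x - y))\<^sup>2"
      using sc unfolding strongly_convex_def g_def by blast
    moreover have "\<alpha> / 2 * (norm (x - y))\<^sup>2 \<ge> 0"
      using \<open>\<alpha> > 0\<close> by simp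
    ultimately show "f x - f y \<le> g \<bullet> (x - y)"
      by linarith
  qed (use q in simp)
  moreover have "q * (f x - f m) \<le> q * (g \<bullet> (x - m) - \<alpha> / 2 * (norm (x - m))\<^sup>2)"
    using sc q unfolding strongly_convex_def g_def by (intro mult_left_mono) auto
  ultimately show ?thesis
    using dist unfolding q_def[symmetric]
    by (simp add: algebra_simps add_divide_distrib diff_divide_distrib)
qed

theorem theorem3p18:
  fixes f :: "real ^ 'n \<Rightarrow> real"
    and \<alpha> \<beta> \<kappa> :: real
    and xstar :: "real ^ 'n"
    and x y :: "nat \<Rightarrow> real ^ 'n"
  assumes "\<alpha> > 0" and "\<beta> > 0"
    and "strongly_convex \<alpha> f"
    and "smooth \<beta> f"
    and "\<kappa> = \<beta> / \<alpha>"
    and "\<forall>z. f xstar \<le> f z"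
    and "x 1 = y 1"
    and "\<forall>t\<ge>1. y (t + 1) = x t - (1 / \<beta>) *\<^sub>R grad f (x t)"
    and "\<forall>t\<ge>1. x (t + 1) = (1 + (sqrt \<kappa> - 1) / (sqrt \<kappa> + 1)) *\<^sub>R y (t + 1)
                          - ((sqrt \<kappa> - 1) / (sqrt \<kappa> + 1)) *\<^sub>R y t"
  shows "\<forall>t\<ge>1. f (y t) - f xstar
           \<le> (\<alpha> + \<beta>) / 2 * (norm (x 1 - xstar))\<^sup>2 * exp (- (real t - 1) / sqrt \<kappa>)"
proof (intro allI impI)
  fix t :: nat
  assume "t \<ge> 1"
  define s where "s = sqrt \<kappa>"
  define z where "z t = (1 + s) *\<^sub>R x t - s *\<^sub>R y t" for t
  define V where "V t = f (y t) - f xstar + \<alpha> / 2 * (norm (z t - xstar))\<^sup>2" for t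
  have "\<alpha> \<le> \<beta>"
    using assms(3,4) by (rule strongly_convex_smooth_le)
  then have "s \<ge> 1"
    using assms(1,5) by (simp add: s_def)
  have "s\<^sup>2 = \<kappa>"
    using assms(1,2,5) by (simp add: s_def)
  then have \<beta>: "\<beta> = \<alpha> * s\<^sup>2"
    using assms(1,5) by simp
  have step: "V (t + 1) \<le> (1 - 1 / s) * V t" if "t \<ge> 1" for t
  proof -
    have "z (t + 1) = s *\<^sub>R y (t + 1) - (s - 1) *\<^sub>R y t"
    proof -
      have "(1 + s) * ((s - 1) / (s + 1)) = s - 1"
        using \<open>s \<ge> 1\<close> by (simp add: field_simps)
      then have "(1 + s) *\<^sub>R x (t + 1) = (1 + s + (s - 1)) *\<^sub>R y (t + 1) - (s - 1) *\<^sub>R y t"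
        using assms(9) that unfolding s_def[symmetric]
        by (simp add: scaleR_diff_right distrib_left del: divide_divide_eq_right times_divide_eq_right)
      moreover have "z (t + 1) = (1 + s) *\<^sub>R x (t + 1) - s *\<^sub>R y (t + 1)"
        by (rule z_def)
      ultimately show ?thesis
        by (simp only: scaleR_add_left scaleR_diff_left) simp
    qed
    then show ?thesis
      unfolding V_def
      using nesterov_potential_step[OF assms(1) \<open>s \<ge> 1\<close> \<beta> assms(3,4)] assms(8) that z_def by blast
  qed
  have V1: "V 1 \<le> (\<alpha> + \<beta>) / 2 * (norm (x 1 - xstar))\<^sup>2"
  proof -
    have "z 1 = x 1"
      using assms(7) by (simp add: z_def algebra_simps)
    moreover have "f (x 1) - f xstar \<le> \<beta> / 2 * (norm (x 1 - xstar))\<^sup>2"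
      using assms(2,4,6) by (blast intro: smooth_growth_from_minimizer)
    ultimately show ?thesis
      using assms(7) by (simp add: V_def algebra_simps add_divide_distrib)
  qed
  have rate: "0 \<le> 1 - 1 / s"
    using \<open>s \<ge> 1\<close> by simp
  have V_nonneg: "0 \<le> V t" for t
    using assms(1,6) by (simp add: V_def)
  have "V t \<le> (1 - 1 / s) ^ (t - 1) * V 1"
    using \<open>t \<ge> 1\<close>
  proof (induction t rule: nat_induct_at_least)
    case (Suc n)
    have "V (Suc n) \<le> (1 - 1 / s) * V n"
      using step Suc.hyps by simp
    also have "\<dots> \<le> (1 - 1 / s) * ((1 - 1 / s) ^ (n - 1) * V 1)"
      using Suc.IH rate by (rule mult_left_mono)
    also have "\<dots> = (1 - 1 / s) ^ (Suc n - 1) * V 1"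
      using Suc.hyps by (simp add: power_eq_if)
    finally show ?case .
  qed simp
  also have "\<dots> \<le> exp (- (1 / s)) ^ (t - 1) * ((\<alpha> + \<beta>) / 2 * (norm (x 1 - xstar))\<^sup>2)"
    using rate V1 V_nonneg exp_ge_add_one_self[of "- (1 / s)"] by (intro mult_mono power_mono) auto
  also have "exp (- (1 / s)) ^ (t - 1) = exp (- (real t - 1) / sqrt \<kappa>)"
    using \<open>t \<ge> 1\<close> by (simp add: exp_of_nat_mult[symmetric] of_nat_diff s_def diff_divide_distrib)
  finally have "V t \<le> (\<alpha> + \<beta>) / 2 * (norm (x 1 - xstar))\<^sup>2 * exp (- (real t - 1) / sqrt \<kappa>)"
    by (simp only: mult.commute)
  moreover have "f (y t) - f xstar \<le> V t"
    using assms(1) by (simp add: V_def)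
  ultimately show "f (y t) - f xstar
      \<le> (\<alpha> + \<beta>) / 2 * (norm (x 1 - xstar))\<^sup>2 * exp (- (real t - 1) / sqrt \<kappa>)"
    by linarith
qed

end
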